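(* Let $G$ be a finite group and let $n\geq 1$ be an integer. Then $\mathscr{I}_c(G)\cong P_n$ if and only if $n=1$ and $G\cong \mathbb{Z}_{p^3}$ for some prime $p$.
   Context: For a group $G$, the intersection graph of cyclic subgroups of $G$, denoted $\mathscr{I}_c(G)$, is the simple graph whose vertices are all the proper cyclic subgroups of $G$ (cyclic subgroups different from $G$ and from the trivial subgroup), two distinct vertices being adjacent if and only if their intersection is a non-trivial subgroup. $P_n$ denotes the path with $n$ edges (so with $n+1$ vertices). $\mathbb{Z}_m$ is the cyclic group of order $m$. *)

theory Defs
  imports
    "HOL-Computational_Algebra.Primes"
    "HOL-Algebra.Elementary_Groups"
    "Graph_Theory.Digraph_Isomorphism"
    "Graph_Theory.Pair_Digraph"
begin

definition proper_cyclic_subgroups :: "('a, 'b) monoid_scheme \<Rightarrow> 'a set set" where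
  "proper_cyclic_subgroups G =
     {H. subgroup H G \<and> cyclic_group (G\<lparr>carrier := H\<rparr>) \<and> H \<noteq> carrier G \<and> H \<noteq> {\<one>\<^bsub>G\<^esub>}}"

text \<open>As in the graph library, an undirected edge is represented by its two opposite arcs.\<close>

definition cyclic_intersection_graph :: "('a, 'b) monoid_scheme \<Rightarrow> 'a set pair_pre_digraph" where
  "cyclic_intersection_graph G =
     \<lparr> pverts = proper_cyclic_subgroups G,
       parcs = {(H, K). H \<in> proper_cyclic_subgroups G \<and> K \<in> proper_cyclic_subgroups G \<and>
                        H \<noteq> K \<and> H \<inter> K \<noteq> {\<one>\<^bsub>G\<^esub>}} \<rparr>"

text \<open>The index counts edges: the path has \<open>n\<close> edges and \<open>n + 1\<close> vertices.\<close>

definition path_graph :: "nat \<Rightarrow> nat pair_pre_digraph" where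
  "path_graph n =
     \<lparr> pverts = {0..n},
       parcs = {(i, j). i \<in> {0..n} \<and> j \<in> {0..n} \<and> (j = Suc i \<or> i = Suc j)} \<rparr>"

lemma pair_graph_path_graph: "pair_graph (path_graph n)"
proof -
  have "finite {(i, j). i \<in> {0..n} \<and> j \<in> {0..n} \<and> (j = Suc i \<or> i = Suc j)}"
    by (rule finite_subset[of _ "{0..n} \<times> {0..n}"]) auto
  then show ?thesis
    by unfold_locales (auto simp: path_graph_def symmetric_def sym_def)
qed

lemma pair_graph_cyclic_intersection_graph:
  assumes "finite (carrier G)"
  shows "pair_graph (cyclic_intersection_graph G)"
proof -
  have "proper_cyclic_subgroups G \<subseteq> Pow (carrier G)"
    by (auto simp: proper_cyclic_subgroups_def dest: subgroup.subset)
  then have fin: "finite (proper_cyclic_subgroups G)"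
    using assms by (meson finite_Pow_iff finite_subset)
  have "finite {(H, K). H \<in> proper_cyclic_subgroups G \<and> K \<in> proper_cyclic_subgroups G \<and>
                        H \<noteq> K \<and> H \<inter> K \<noteq> {\<one>\<^bsub>G\<^esub>}}"
    by (rule finite_subset[OF _ finite_cartesian_product[OF fin fin]]) auto
  with fin show ?thesis
    by unfold_locales (auto simp: cyclic_intersection_graph_def symmetric_def sym_def)
qed

end

theory Submission
  imports Defs "HOL-Algebra.Multiplicative_Group"
begin

text \<open>
  Suppose the intersection graph is a path with at least one edge. A path has no triangle, and this
  forces adjacent vertices to be nested: if \<open>H\<close> and \<open>K\<close> meet in some \<open>z \<noteq> \<one>\<close>, then the subgroup
  generated by \<open>z\<close> would form a triangle with them unless it is one of them
  (\<open>adjacent_comparable_if_triangle_free\<close>). Hence three vertices never form a chain. Take an edge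
  \<open>A \<subset> B\<close>. No vertex lies strictly above \<open>B\<close>, so all neighbours of \<open>B\<close> are below it, and a neighbour of
  such a neighbour is below \<open>B\<close> again. As a path is connected, \<open>B\<close> contains every proper cyclic
  subgroup (\<open>greatest_if_path\<close>).

  An element outside \<open>B\<close> therefore generates \<open>G\<close>, so \<open>G\<close> is cyclic. Its subgroups correspond to the
  divisors of its order, and a greatest proper divisor that is a multiple of all other proper
  divisors exists only for a prime power (\<open>cyclic_p_group_if_greatest\<close>).

  In a cyclic group of order \<open>p\<^sup>k\<close> the subgroups form a chain, so its intersection graph is the
  complete graph on \<open>k - 1\<close> vertices. A complete graph is a path with \<open>n \<ge> 1\<close> edges exactly when it
  has two vertices, which means \<open>n = 1\<close> and \<open>k = 3\<close>. The same description of the graph gives the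
  converse.
\<close>

section \<open>Isomorphism of simple graphs on vertex functions\<close>

text \<open>Arcs of these graphs are pairs of vertices, so the arc part of an isomorphism is determined by its
  vertex part. This reduces the library notion, which carries separate maps for vertices, arcs, heads
  and tails, to the usual bijection that preserves and reflects adjacency.\<close>

lemma digraph_iso_with_proj_iff:
  assumes A: "wf_digraph (with_proj A)" and B: "wf_digraph (with_proj B)"
  shows "digraph_iso (with_proj A) (with_proj B) \<longleftrightarrow>
    (\<exists>f. bij_betw f (pverts A) (pverts B) \<and>
      (\<forall>u\<in>pverts A. \<forall>v\<in>pverts A. (u, v) \<in> parcs A \<longleftrightarrow> (f u, f v) \<in> parcs B))"
    (is "?iso \<longleftrightarrow> (\<exists>f. ?vertex_iso f)")
proof
  have subA: "parcs A \<subseteq> pverts A \<times> pverts A"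
    using wf_digraph.tail_in_verts[OF A] wf_digraph.head_in_verts[OF A] by auto
  have subB: "parcs B \<subseteq> pverts B \<times> pverts B"
    using wf_digraph.tail_in_verts[OF B] wf_digraph.head_in_verts[OF B] by auto
  {
    assume ?iso
    then obtain h where h: "pre_digraph.digraph_isomorphism (with_proj A) h"
      and eq: "with_proj B = app_iso h (with_proj A)"
      by (auto simp: digraph_iso_def)
    define f where "f = iso_verts h"
    have fields: "pverts B = f ` pverts A" "parcs B = iso_arcs h ` parcs A"
        "iso_tail h = fst" "iso_head h = snd"
      using eq by (auto simp: with_proj_def app_iso_def f_def)
    have inj: "inj_on f (pverts A)"
      using h by (simp add: pre_digraph.digraph_isomorphism_def f_def)
    have "iso_arcs h (u, v) = (f u, f v)" if "(u, v) \<in> parcs A" for u v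
      using h that fields by (force simp: pre_digraph.digraph_isomorphism_def f_def prod_eq_iff)
    then have arcs: "parcs B = (\<lambda>(u, v). (f u, f v)) ` parcs A"
      unfolding fields(2) by (intro image_cong) auto
    have "(u, v) \<in> parcs A \<longleftrightarrow> (f u, f v) \<in> parcs B" if "u \<in> pverts A" "v \<in> pverts A" for u v
    proof
      assume "(f u, f v) \<in> parcs B"
      then obtain u' v' where "(u', v') \<in> parcs A" "f u = f u'" "f v = f v'"
        unfolding arcs by auto
      then show "(u, v) \<in> parcs A"
        using inj that subA by (auto dest: inj_onD)
    qed (auto simp: arcs)
    then show "\<exists>f. ?vertex_iso f"
      using inj fields(1) by (auto simp: bij_betw_def)
  next
    assume "\<exists>f. ?vertex_iso f"
    then obtain f where f: "?vertex_iso f" by blast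
    then have inj: "inj_on f (pverts A)" and img: "f ` pverts A = pverts B"
      by (auto simp: bij_betw_def)
    define h where "h = \<lparr>iso_verts = f, iso_arcs = map_prod f f, iso_head = snd, iso_tail = fst\<rparr>"
    have "inj_on (map_prod f f) (parcs A)"
      using map_prod_inj_on[OF inj inj] subA by (rule inj_on_subset)
    then have "pre_digraph.digraph_isomorphism (with_proj A) h"
      using A inj by (simp add: pre_digraph.digraph_isomorphism_def h_def)
    moreover have "map_prod f f ` parcs A = parcs B"
    proof
      show "map_prod f f ` parcs A \<subseteq> parcs B"
        using f subA by fastforce
      show "parcs B \<subseteq> map_prod f f ` parcs A"
      proof
        fix e assume e: "e \<in> parcs B"
        then obtain u v where "u \<in> pverts A" "v \<in> pverts A" "e = (f u, f v)"
          using subB img by (cases e) blast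
        then show "e \<in> map_prod f f ` parcs A"
          using f e by (force intro!: image_eqI[of _ _ "(u, v)"])
      qed
    qed
    then have "with_proj B = app_iso h (with_proj A)"
      using img by (simp add: with_proj_def app_iso_def h_def)
    ultimately show ?iso
      by (auto simp: digraph_iso_def)
  }
qed

section \<open>Cyclic subgroups\<close>

lemma cyclic_integer_mod_group:
  assumes "m > 1"
  shows "cyclic_group (integer_mod_group m)"
proof -
  have "{0..<int m} = range (\<lambda>i. i mod int m)"
  proof
    show "{0..<int m} \<subseteq> range (\<lambda>i. i mod int m)"
      by (metis atLeastLessThan_iff mod_pos_pos_trivial rangeI subsetI)
    show "range (\<lambda>i. i mod int m) \<subseteq> {0..<int m}"
      using assms by auto
  qed
  then have "carrier (integer_mod_group m) = range (\<lambda>i::int. 1 [^]\<^bsub>integer_mod_group m\<^esub> i)"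
    using assms by (simp add: int_pow_integer_mod_group carrier_integer_mod_group)
  moreover have "1 \<in> carrier (integer_mod_group m)"
    using assms by simp
  ultimately show ?thesis
    using group.cyclic_group[OF group_integer_mod_group] by blast
qed

context group
begin

lemma generate_eq_range_int_pow:
  assumes "x \<in> carrier G"
  shows "generate G {x} = range (\<lambda>n::int. x [^] n)"
  using generate_pow[OF assms] by auto

text \<open>Passes from the subgroup seen as a group of its own, with its own powers, to a generator in the
  ambient group, with which all later arguments work.\<close>

lemma cyclic_subgroup_iff_generate:
  "subgroup H G \<and> cyclic_group (G\<lparr>carrier := H\<rparr>) \<longleftrightarrow> (\<exists>x\<in>carrier G. H = generate G {x})"
proof
  assume H: "subgroup H G \<and> cyclic_group (G\<lparr>carrier := H\<rparr>)"
  then interpret K: group "G\<lparr>carrier := H\<rparr>"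
    by (simp add: subgroup.subgroup_is_group)
  obtain x where x: "x \<in> H" "H = range (\<lambda>n::int. x [^]\<^bsub>G\<lparr>carrier := H\<rparr>\<^esub> n)"
    using H K.cyclic_group by auto
  have "range (\<lambda>n::int. x [^] n) = range (\<lambda>n::int. x [^]\<^bsub>G\<lparr>carrier := H\<rparr>\<^esub> n)"
    using int_pow_consistent[OF conjunct1[OF H] x(1)] by simp
  with x(2) have "H = range (\<lambda>n::int. x [^] n)"
    by (rule trans[OF _ sym])
  moreover have "x \<in> carrier G"
    using x H subgroup.subset by blast
  ultimately have "H = generate G {x}"
    by (simp only: generate_eq_range_int_pow)
  with \<open>x \<in> carrier G\<close> show "\<exists>x\<in>carrier G. H = generate G {x}" ..
next
  assume "\<exists>x\<in>carrier G. H = generate G {x}"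
  then obtain x where x: "x \<in> carrier G" "H = generate G {x}" by blast
  then have H: "subgroup H G"
    by (simp add: generate_is_subgroup)
  then interpret K: group "G\<lparr>carrier := H\<rparr>"
    by (simp add: subgroup.subgroup_is_group)
  have "x \<in> H" using x by (simp add: generate.incl)
  moreover have "range (\<lambda>n::int. x [^] n) = range (\<lambda>n::int. x [^]\<^bsub>G\<lparr>carrier := H\<rparr>\<^esub> n)"
    using int_pow_consistent[OF H \<open>x \<in> H\<close>] by simp
  then have "H = range (\<lambda>n::int. x [^]\<^bsub>G\<lparr>carrier := H\<rparr>\<^esub> n)"
    using x(2) generate_eq_range_int_pow[OF x(1)] by (metis (no_types))
  ultimately show "subgroup H G \<and> cyclic_group (G\<lparr>carrier := H\<rparr>)"
    using H K.cyclic_group by (metis partial_object.select_convs(1) partial_object.surjective partial_object.update_convs(1))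
qed

lemma mem_proper_cyclic_subgroups_iff:
  "H \<in> proper_cyclic_subgroups G \<longleftrightarrow>
    (\<exists>x\<in>carrier G. H = generate G {x}) \<and> H \<noteq> carrier G \<and> H \<noteq> {\<one>}"
  using cyclic_subgroup_iff_generate by (auto simp: proper_cyclic_subgroups_def)

lemma generate_subset_generate_iff:
  assumes "x \<in> carrier G" "y \<in> carrier G"
  shows "generate G {x} \<subseteq> generate G {y} \<longleftrightarrow> x \<in> generate G {y}"
  using assms generate.incl[of x "{x}"] generate_is_subgroup[of "{y}"]
    generate_subgroup_incl[of "{x}" "generate G {y}"] by auto

lemma generate_eq_one_iff:
  assumes "x \<in> carrier G"
  shows "generate G {x} = {\<one>} \<longleftrightarrow> x = \<one>"
  using assms generate.incl[of x "{x}"] generate_one by auto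

end

locale finite_cyclic_group = group +
  fixes g
  assumes finite_carrier: "finite (carrier G)"
    and generator_closed: "g \<in> carrier G"
    and generate_generator: "generate G {g} = carrier G"
begin

lemma ord_generator: "ord g = order G"
  using generate_pow_card[OF generator_closed] generate_generator by (simp add: order_def)

lemma order_pos: "order G > 0"
  using finite_carrier order_gt_0_iff_finite by simp

text \<open>The uniqueness of the subgroup of a given order. Write \<open>N\<close> for the order of \<open>G\<close>, \<open>d\<close> for that of \<open>x\<close>,
  and \<open>x = g\<^sup>k\<close>. Since \<open>x\<^sup>d = \<one>\<close>, the order \<open>N\<close> divides \<open>k d\<close>, so \<open>N / d\<close> divides \<open>k\<close>. Thus \<open>x\<close> lies
  in the subgroup generated by the power of \<open>g\<close> with exponent \<open>N / d\<close>, which also has \<open>d\<close> elements.\<close>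

lemma generate_eq_generate_power:
  assumes x: "x \<in> carrier G"
  shows "generate G {x} = generate G {g [^] (order G div ord x)}"
proof (rule card_subset_eq)
  let ?e = "order G div ord x"
  have dvd: "ord x dvd order G" using x by (rule ord_dvd_group_order)
  then have e: "?e dvd ord g" "?e \<noteq> 0" "order G = ?e * ord x"
    using order_pos by (auto simp: ord_generator elim!: dvdE)
  have closed: "g [^] ?e \<in> carrier G" using generator_closed by simp
  show "finite (generate G {g [^] ?e})"
    using finite_carrier closed generate_incl[of "{g [^] ?e}"] by (auto intro: finite_subset)
  obtain k :: nat where k: "x = g [^] k"
    using x generate_pow_on_finite_carrier[OF finite_carrier generator_closed] generate_generator
    by auto
  have "g [^] (k * ord x) = \<one>"
    using pow_ord_eq_1[OF x] generator_closed by (metis k nat_pow_pow)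
  then have "?e * ord x dvd k * ord x"
    using generator_closed e(3) by (simp add: pow_eq_id ord_generator)
  then have "?e dvd k"
    using ord_ge_1[OF finite_carrier x] by simp
  then obtain j where "k = ?e * j" by (elim dvdE)
  then have "x = (g [^] ?e) [^] j"
    using generator_closed by (simp add: k nat_pow_pow)
  then have "x \<in> generate G {g [^] ?e}"
    using generate_pow_on_finite_carrier[OF finite_carrier closed] by auto
  then show "generate G {x} \<subseteq> generate G {g [^] ?e}"
    using x closed generate_subset_generate_iff by blast
  have "ord (g [^] ?e) = ord x"
    using ord_pow[OF generator_closed e(1,2)] e(2,3)
    by (metis nonzero_mult_div_cancel_left ord_generator)
  then show "card (generate G {x}) = card (generate G {g [^] ?e})"
    using generate_pow_card x closed by simp
qed

text \<open>Embeds the cyclic subgroups into the divisor lattice of the group order. For the direction from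
  divisibility, both subgroups are replaced by their canonical generators, powers of \<open>g\<close> whose
  exponents are then multiples of one another.\<close>

lemma generate_subset_iff_ord_dvd:
  assumes "x \<in> carrier G" "y \<in> carrier G"
  shows "generate G {x} \<subseteq> generate G {y} \<longleftrightarrow> ord x dvd ord y"
proof
  assume "generate G {x} \<subseteq> generate G {y}"
  then have "x \<in> generate G {y}"
    using assms generate_subset_generate_iff by blast
  then obtain k :: nat where "x = y [^] k"
    using generate_pow_on_finite_carrier[OF finite_carrier assms(2)] by auto
  then have "x [^] ord y = \<one>"
    using assms by (metis nat_pow_pow mult.commute pow_ord_eq_1 nat_pow_one)
  then show "ord x dvd ord y"
    using assms pow_eq_id by blast
next
  assume "ord x dvd ord y"
  moreover have "ord y dvd order G" using assms(2) by (rule ord_dvd_group_order)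
  ultimately obtain a b where a: "ord y = ord x * a" and b: "order G = ord y * b"
    by (elim dvdE)
  let ?z = "g [^] (order G div ord y)"
  have z: "?z \<in> carrier G" using generator_closed by simp
  have "order G div ord x = (order G div ord y) * a"
    using a b order_pos by (auto simp: mult_ac)
  then have "g [^] (order G div ord x) = ?z [^] a"
    using generator_closed by (simp add: nat_pow_pow)
  then have "g [^] (order G div ord x) \<in> generate G {?z}"
    using generate_pow_on_finite_carrier[OF finite_carrier z] by auto
  then show "generate G {x} \<subseteq> generate G {y}"
    using generate_eq_generate_power[OF assms(1)] generate_eq_generate_power[OF assms(2)]
      z generator_closed generate_subset_generate_iff by (metis nat_pow_closed)
qed

lemma exists_element_of_order:
  assumes "d dvd order G"
  shows "\<exists>x\<in>carrier G. ord x = d"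
proof -
  obtain e where e: "order G = d * e" using assms by (elim dvdE)
  then have "ord (g [^] e) = d"
    using ord_pow[OF generator_closed, of e] order_pos by (simp add: ord_generator)
  then show ?thesis using generator_closed by blast
qed

lemma generate_eq_carrier_iff:
  assumes "x \<in> carrier G"
  shows "generate G {x} = carrier G \<longleftrightarrow> ord x = order G"
proof -
  have "generate G {x} \<subseteq> carrier G" using assms by (simp add: generate_incl)
  then show ?thesis
    using card_subset_eq[OF finite_carrier] generate_pow_card[OF assms] by (auto simp: order_def)
qed

lemma generate_mem_proper_cyclic_subgroups_iff:
  assumes "x \<in> carrier G"
  shows "generate G {x} \<in> proper_cyclic_subgroups G \<longleftrightarrow> ord x \<noteq> 1 \<and> ord x \<noteq> order G"
  using assms generate_eq_carrier_iff[OF assms] generate_eq_one_iff[OF assms] ord_eq_1[OF assms]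
  unfolding mem_proper_cyclic_subgroups_iff by blast

lemma bij_betw_card_proper_cyclic_subgroups:
  "bij_betw card (proper_cyclic_subgroups G) {d. d dvd order G \<and> d \<noteq> 1 \<and> d \<noteq> order G}"
proof (rule bij_betwI')
  fix H K assume "H \<in> proper_cyclic_subgroups G" "K \<in> proper_cyclic_subgroups G"
  then obtain x y where "x \<in> carrier G" "H = generate G {x}" "y \<in> carrier G" "K = generate G {y}"
    by (auto simp: mem_proper_cyclic_subgroups_iff)
  then show "card H = card K \<longleftrightarrow> H = K"
    using generate_subset_iff_ord_dvd generate_pow_card by (metis dvd_refl subset_antisym)
next
  fix H assume H: "H \<in> proper_cyclic_subgroups G"
  then obtain x where x: "x \<in> carrier G" "H = generate G {x}"
    by (auto simp: mem_proper_cyclic_subgroups_iff)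
  then have "ord x \<noteq> 1 \<and> ord x \<noteq> order G"
    using H generate_mem_proper_cyclic_subgroups_iff by blast
  then show "card H \<in> {d. d dvd order G \<and> d \<noteq> 1 \<and> d \<noteq> order G}"
    using x ord_dvd_group_order generate_pow_card by simp
next
  fix d assume d: "d \<in> {d. d dvd order G \<and> d \<noteq> 1 \<and> d \<noteq> order G}"
  then obtain x where x: "x \<in> carrier G" "ord x = d"
    using exists_element_of_order by auto
  then have "generate G {x} \<in> proper_cyclic_subgroups G"
    using d generate_mem_proper_cyclic_subgroups_iff by blast
  then show "\<exists>H\<in>proper_cyclic_subgroups G. d = card H"
    using x generate_pow_card by metis
qed

text \<open>The isomorphism sends a residue \<open>i\<close> to \<open>g\<^sup>i\<close>: two powers of \<open>g\<close> agree exactly when their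
  exponents are congruent modulo the order.\<close>

lemma is_iso_integer_mod_group: "G \<cong> integer_mod_group (order G)"
proof -
  let ?Z = "integer_mod_group (order G)" and ?f = "\<lambda>i::int. g [^] i"
  have Z: "carrier ?Z = {0..<int (order G)}"
    using order_pos by (simp add: carrier_integer_mod_group)
  have eq_iff: "g [^] i = g [^] j \<longleftrightarrow> int (order G) dvd i - j" for i j :: int
    using generator_closed int_pow_eq_id[OF generator_closed, of "i - j"]
    by (simp add: int_pow_diff ord_generator r_inv_ex inv_solve_right')
  have "?f \<in> hom ?Z G"
  proof (rule homI)
    fix i j :: int
    show "g [^] (i \<otimes>\<^bsub>?Z\<^esub> j) = g [^] i \<otimes> g [^] j"
      using generator_closed eq_iff[of "(i + j) mod int (order G)" "i + j"]
      by (simp add: int_pow_mult mod_eq_dvd_iff[symmetric])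
  qed (use generator_closed in simp)
  moreover have "inj_on ?f (carrier ?Z)"
    by (auto simp: inj_on_def Z eq_iff zdvd_not_zless mod_eq_dvd_iff[symmetric])
  moreover have "?f ` carrier ?Z = carrier G"
  proof (rule card_subset_eq[OF finite_carrier])
    show "?f ` carrier ?Z \<subseteq> carrier G" using generator_closed by auto
    show "card (?f ` carrier ?Z) = card (carrier G)"
      by (subst card_image[OF \<open>inj_on ?f (carrier ?Z)\<close>], subst Z) (simp add: order_def)
  qed
  ultimately have "?f \<in> iso ?Z G"
    by (simp add: iso_def bij_betw_def)
  then have "?Z \<cong> G" by (auto simp: is_iso_def)
  then show ?thesis
    by (rule group.iso_sym[OF group_integer_mod_group])
qed

end

section \<open>Cyclic groups of prime power order\<close>

locale cyclic_p_group = finite_cyclic_group +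
  fixes p k :: nat
  assumes prime_p: "prime p" and order_eq: "order G = p ^ k"
begin

lemma cyclic_subgroups_chain:
  assumes "x \<in> carrier G" "y \<in> carrier G"
  shows "generate G {x} \<subseteq> generate G {y} \<or> generate G {y} \<subseteq> generate G {x}"
proof -
  obtain i j where "ord x = p ^ i" "ord y = p ^ j"
    using assms ord_dvd_group_order divides_primepow_nat[OF prime_p] order_eq by metis
  then show ?thesis
    using assms by (metis generate_subset_iff_ord_dvd le_imp_power_dvd nat_le_linear)
qed

text \<open>The intersection graph of a cyclic \<open>p\<close>-group is complete: the smaller of two nested subgroups is
  their intersection.\<close>

lemma proper_cyclic_subgroups_meet:
  assumes "H \<in> proper_cyclic_subgroups G" "K \<in> proper_cyclic_subgroups G"
  shows "H \<inter> K \<noteq> {\<one>}"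
proof -
  have "H \<subseteq> K \<or> K \<subseteq> H"
    using assms cyclic_subgroups_chain by (auto simp: mem_proper_cyclic_subgroups_iff)
  then show ?thesis
    using assms by (auto simp: mem_proper_cyclic_subgroups_iff Int_absorb1 Int_absorb2)
qed

lemma card_proper_cyclic_subgroups: "card (proper_cyclic_subgroups G) = k - 1"
proof -
  have p: "p > 1" using prime_p by (rule prime_gt_1_nat)
  have "{d. d dvd order G \<and> d \<noteq> 1 \<and> d \<noteq> order G} = (\<lambda>i. p ^ i) ` {1..<k}"
  proof (intro equalityI subsetI)
    fix d assume "d \<in> {d. d dvd order G \<and> d \<noteq> 1 \<and> d \<noteq> order G}"
    then obtain i where i: "i \<le> k" "d = p ^ i" "d \<noteq> 1" "d \<noteq> p ^ k"
      by (auto simp: order_eq divides_primepow_nat[OF prime_p])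
    then have "i \<noteq> 0" "i \<noteq> k" by auto
    with i show "d \<in> (\<lambda>i. p ^ i) ` {1..<k}" by auto
  next
    fix d assume "d \<in> (\<lambda>i. p ^ i) ` {1..<k}"
    then show "d \<in> {d. d dvd order G \<and> d \<noteq> 1 \<and> d \<noteq> order G}"
      using p by (auto simp: order_eq le_imp_power_dvd)
  qed
  moreover have "inj_on (\<lambda>i. p ^ i) {1..<k}"
    using p by (auto simp: inj_on_def)
  ultimately show ?thesis
    using bij_betw_same_card[OF bij_betw_card_proper_cyclic_subgroups] by (simp add: card_image)
qed

end

section \<open>A largest proper cyclic subgroup\<close>

text \<open>If \<open>N\<close> is not a prime power, it is a product of two coprime proper divisors. Both divide \<open>b\<close>,
  hence so does \<open>N\<close>, which makes \<open>b\<close> improper.\<close>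

lemma prime_power_if_greatest_proper_divisor:
  fixes N b :: nat
  assumes b: "N > 0" "b dvd N" "b \<noteq> N"
    and greatest: "\<And>d. d dvd N \<Longrightarrow> d \<noteq> 1 \<Longrightarrow> d \<noteq> N \<Longrightarrow> d dvd b"
  shows "\<exists>p k. prime p \<and> N = p ^ k"
proof -
  have "N \<noteq> 1" using b by auto
  then obtain p where p: "prime p" "p dvd N" using prime_factor_nat by blast
  then obtain m where m: "N = p ^ multiplicity p N * m" "\<not> p dvd m"
    using b(1) multiplicity_decompose'[of N p] by (auto simp: prime_nat_iff)
  have "m = 1"
  proof (rule ccontr)
    assume "m \<noteq> 1"
    have "p ^ multiplicity p N \<noteq> 1"
      using p b(1) by (simp add: prime_multiplicity_gt_zero_iff prime_nat_iff)
    moreover have "p ^ multiplicity p N \<noteq> N"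
      using \<open>m \<noteq> 1\<close> m(1) b(1) by (metis mult_cancel1 mult_1_right not_gr_zero)
    ultimately have "p ^ multiplicity p N dvd b"
      using greatest multiplicity_dvd by blast
    moreover have "m dvd b"
      using greatest[of m] m p \<open>m \<noteq> 1\<close> by (metis dvd_triv_right)
    moreover have "coprime (p ^ multiplicity p N) m"
      using m p by (simp add: prime_imp_coprime)
    ultimately have "N dvd b"
      using m(1) divides_mult by metis
    then show False using b by (simp add: dvd_antisym)
  qed
  then show ?thesis using m p by auto
qed

text \<open>An element outside \<open>B\<close> cannot generate a proper subgroup, so it generates \<open>G\<close>. The order of \<open>B\<close>
  is then a greatest proper divisor of the group order in the sense of
  \<open>prime_power_if_greatest_proper_divisor\<close>.\<close>

lemma (in group) cyclic_p_group_if_greatest: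
  assumes fin: "finite (carrier G)" and B: "B \<in> proper_cyclic_subgroups G"
    and greatest: "\<And>H. H \<in> proper_cyclic_subgroups G \<Longrightarrow> H \<subseteq> B"
  shows "\<exists>g p k. cyclic_p_group G g p k"
proof -
  obtain y where y: "y \<in> carrier G" "B = generate G {y}"
    and B': "B \<noteq> carrier G" "B \<noteq> {\<one>}"
    using B by (auto simp: mem_proper_cyclic_subgroups_iff)
  have "B \<subset> carrier G"
    using B' y generate_incl[of "{y}"] by auto
  then obtain g where g: "g \<in> carrier G" "g \<notin> B" by blast
  have g_in: "g \<in> generate G {g}" by (simp add: generate.incl)
  have "g \<noteq> \<one>"
    using g y generate.one by auto
  then have "generate G {g} = carrier G"
    using g g_in greatest generate_eq_one_iff by (auto simp: mem_proper_cyclic_subgroups_iff)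
  then interpret finite_cyclic_group G g
    using fin g by unfold_locales auto
  have "\<exists>p k. prime p \<and> order G = p ^ k"
  proof (rule prime_power_if_greatest_proper_divisor[OF order_pos, of "ord y"])
    show "ord y dvd order G" using y ord_dvd_group_order by blast
    show "ord y \<noteq> order G" using y B' generate_eq_carrier_iff by blast
    fix d assume d: "d dvd order G" "d \<noteq> 1" "d \<noteq> order G"
    then obtain x where x: "x \<in> carrier G" "ord x = d"
      using exists_element_of_order by blast
    then have "generate G {x} \<subseteq> B"
      using d greatest generate_mem_proper_cyclic_subgroups_iff by blast
    then show "d dvd ord y"
      using x y generate_subset_iff_ord_dvd by blast
  qed
  then obtain p k where "prime p" "order G = p ^ k" by blast
  then have "cyclic_p_group G g p k" by unfold_locales
  then show ?thesis by blast
qed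

section \<open>Paths as intersection graphs\<close>

text \<open>A cyclic subgroup inside the intersection of two adjacent vertices is a vertex adjacent to both,
  so it has to coincide with one of them.\<close>

lemma (in group) adjacent_comparable_if_triangle_free:
  assumes tf: "\<And>X Y Z. \<lbrakk>(X, Y) \<in> parcs (cyclic_intersection_graph G);
      (Y, Z) \<in> parcs (cyclic_intersection_graph G);
      (X, Z) \<in> parcs (cyclic_intersection_graph G)\<rbrakk> \<Longrightarrow> False"
    and HK: "(H, K) \<in> parcs (cyclic_intersection_graph G)"
  shows "H \<subset> K \<or> K \<subset> H"
proof -
  have H: "H \<in> proper_cyclic_subgroups G" and K: "K \<in> proper_cyclic_subgroups G"
    and HK': "H \<noteq> K" "H \<inter> K \<noteq> {\<one>}"
    using HK by (auto simp: cyclic_intersection_graph_def)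
  have sub: "subgroup H G" "subgroup K G"
    using H K by (auto simp: proper_cyclic_subgroups_def)
  then have "\<one> \<in> H \<inter> K" by (simp add: subgroup.one_closed)
  then obtain z where z: "z \<in> H \<inter> K" "z \<noteq> \<one>"
    using HK'(2) by blast
  then have zG: "z \<in> carrier G" using sub subgroup.subset by blast
  let ?Z = "generate G {z}"
  have ZHK: "?Z \<subseteq> H" "?Z \<subseteq> K"
    using z sub generate_subgroup_incl[of "{z}"] by auto
  moreover have "z \<in> ?Z" by (simp add: generate.incl)
  ultimately have meet: "?Z \<inter> H \<noteq> {\<one>}" "?Z \<inter> K \<noteq> {\<one>}"
    using z by auto
  have "H \<subset> carrier G"
    using H sub subgroup.subset by (auto simp: proper_cyclic_subgroups_def)
  then have "?Z \<noteq> carrier G"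
    using ZHK by blast
  then have Z: "?Z \<in> proper_cyclic_subgroups G"
    using z zG generate_eq_one_iff by (auto simp: mem_proper_cyclic_subgroups_iff)
  have "?Z = H \<or> ?Z = K"
    using tf[of ?Z H K] Z H K meet HK by (auto simp: cyclic_intersection_graph_def)
  then show ?thesis using ZHK HK' by auto
qed

text \<open>The subgroup \<open>B\<close> is the larger end of an edge. The property of lying below \<open>B\<close> passes
  from a vertex to its neighbours, and so spreads along the path in both directions from \<open>B\<close>.\<close>

lemma (in group) greatest_if_path:
  assumes v: "bij_betw v {0..n} (proper_cyclic_subgroups G)" and "n \<ge> 1"
    and adj: "\<And>i j. i \<le> n \<Longrightarrow> j \<le> n \<Longrightarrow>
      (v i, v j) \<in> parcs (cyclic_intersection_graph G) \<longleftrightarrow> j = Suc i \<or> i = Suc j"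
  shows "\<exists>B\<in>proper_cyclic_subgroups G. \<forall>H\<in>proper_cyclic_subgroups G. H \<subseteq> B"
proof -
  let ?E = "parcs (cyclic_intersection_graph G)"
  have E: "(X, Y) \<in> ?E \<longleftrightarrow> X \<in> proper_cyclic_subgroups G \<and> Y \<in> proper_cyclic_subgroups G \<and>
      X \<noteq> Y \<and> X \<inter> Y \<noteq> {\<one>}" for X Y
    by (simp add: cyclic_intersection_graph_def)
  have vertex: "\<exists>i\<le>n. X = v i" if "X \<in> proper_cyclic_subgroups G" for X
    using that bij_betw_imp_surj_on[OF v] by (metis atLeastAtMost_iff imageE)
  have tf: False if "(X, Y) \<in> ?E" "(Y, Z) \<in> ?E" "(X, Z) \<in> ?E" for X Y Z
  proof -
    have "X \<in> proper_cyclic_subgroups G" "Y \<in> proper_cyclic_subgroups G" "Z \<in> proper_cyclic_subgroups G"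
      using that by (simp_all only: E)
    from vertex[OF this(1)] vertex[OF this(2)] vertex[OF this(3)]
    obtain i j k where ijk: "i \<le> n" "j \<le> n" "k \<le> n" "X = v i" "Y = v j" "Z = v k"
      by (elim exE conjE)
    then have "j = Suc i \<or> i = Suc j" "k = Suc j \<or> j = Suc k" "k = Suc i \<or> i = Suc k"
      using that adj by (simp_all only:)
    then show False by linarith
  qed
  have comparable: "X \<subset> Y \<or> Y \<subset> X" if "(X, Y) \<in> ?E" for X Y
    using adjacent_comparable_if_triangle_free[OF _ that] tf by blast
  have nested: "(X, Y) \<in> ?E"
    if "X \<in> proper_cyclic_subgroups G" "Y \<in> proper_cyclic_subgroups G" "X \<subset> Y" for X Y
  proof -
    have "X \<noteq> {\<one>}" using that(1) by (simp add: proper_cyclic_subgroups_def)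
    moreover have "X \<inter> Y = X" using that(3) by blast
    ultimately show ?thesis using that by (simp add: E psubset_imp_subset less_imp_neq)
  qed
  have "(v 0, v 1) \<in> ?E" using adj \<open>n \<ge> 1\<close> by auto
  then obtain A B where A: "A \<in> proper_cyclic_subgroups G" and B: "B \<in> proper_cyclic_subgroups G"
    and AB: "A \<subset> B"
    using comparable[of "v 0" "v 1"] unfolding E by blast
  have neighbour_below: "Y \<subseteq> B" if XY: "(X, Y) \<in> ?E" and X: "X \<subseteq> B" for X Y
  proof (rule ccontr)
    assume Y: "\<not> Y \<subseteq> B"
    have mem: "X \<in> proper_cyclic_subgroups G" "Y \<in> proper_cyclic_subgroups G"
      using XY E by auto
    have "X \<subset> Y" using comparable[OF XY] X Y by auto
    \<comment> \<open>As \<open>X\<close> lies below both \<open>B\<close> and \<open>Y\<close>, these two meet, so \<open>A \<subset> B \<subset> Y\<close> will be a triangle.\<close>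
    have "(B, Y) \<in> ?E"
    proof (cases "X = B")
      case False
      have "\<one> \<in> B \<inter> Y" "X \<noteq> {\<one>}" "\<one> \<in> X"
        using mem B by (auto simp: proper_cyclic_subgroups_def subgroup.one_closed)
      then show ?thesis
        using mem B X Y \<open>X \<subset> Y\<close> by (auto simp: E)
    qed (use XY in simp)
    then have "B \<subset> Y" using comparable Y by blast
    then show False
      using tf[of A B Y] nested A B AB mem by blast
  qed
  obtain b where b: "b \<le> n" "v b = B" using vertex B by blast
  have up: "v j \<subseteq> B" if "b \<le> j" "j \<le> n" for j
    using that
  proof (induction j rule: dec_induct)
    case (step m)
    then show ?case using neighbour_below[of "v m" "v (Suc m)"] adj by simp
  qed (use b in simp)
  have down: "v j \<subseteq> B" if "j \<le> b" for j
    using that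
  proof (induction j rule: inc_induct)
    case (step m)
    then show ?case using neighbour_below[of "v (Suc m)" "v m"] b adj by simp
  qed (use b in simp)
  have "v j \<subseteq> B" if "j \<le> n" for j
    using up down that nat_le_linear by blast
  then have "\<forall>H\<in>proper_cyclic_subgroups G. H \<subseteq> B"
    using vertex by metis
  with B show ?thesis ..
qed

lemma digraph_iso_path_graph_iff:
  "digraph_iso (with_proj (cyclic_intersection_graph G)) (with_proj (path_graph n)) \<longleftrightarrow>
    (\<exists>f. bij_betw f (proper_cyclic_subgroups G) {0..n} \<and>
      (\<forall>H\<in>proper_cyclic_subgroups G. \<forall>K\<in>proper_cyclic_subgroups G.
        (H, K) \<in> parcs (cyclic_intersection_graph G) \<longleftrightarrow> f K = Suc (f H) \<or> f H = Suc (f K)))"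
    (is "?iso \<longleftrightarrow> (\<exists>f. ?P f)")
proof -
  have wf: "wf_digraph (with_proj (cyclic_intersection_graph G))" "wf_digraph (with_proj (path_graph n))"
    by (unfold_locales; auto simp: cyclic_intersection_graph_def path_graph_def)+
  have "?iso \<longleftrightarrow> (\<exists>f. bij_betw f (proper_cyclic_subgroups G) {0..n} \<and>
      (\<forall>H\<in>proper_cyclic_subgroups G. \<forall>K\<in>proper_cyclic_subgroups G.
        (H, K) \<in> parcs (cyclic_intersection_graph G) \<longleftrightarrow> (f H, f K) \<in> parcs (path_graph n)))"
    using digraph_iso_with_proj_iff[OF wf] by (simp add: cyclic_intersection_graph_def path_graph_def)
  also have "\<dots> \<longleftrightarrow> (\<exists>f. ?P f)"
    by (intro ex_cong1 conj_cong refl ball_cong) (auto simp: path_graph_def dest: bij_betw_apply)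
  finally show ?thesis .
qed

theorem theorem2p6:
  fixes G :: "('a, 'b) monoid_scheme" and n :: nat
  assumes "group G" and "finite (carrier G)" and "n \<ge> 1"
  shows "digraph_iso (with_proj (cyclic_intersection_graph G)) (with_proj (path_graph n))
         \<longleftrightarrow> n = 1 \<and> (\<exists>p::nat. prime p \<and> G \<cong> integer_mod_group (p ^ 3))"
proof
  interpret group G by fact
  let ?C = "proper_cyclic_subgroups G" and ?E = "parcs (cyclic_intersection_graph G)"
  {
    assume "digraph_iso (with_proj (cyclic_intersection_graph G)) (with_proj (path_graph n))"
    then obtain f where f: "bij_betw f ?C {0..n}"
      and f_adj: "\<And>H K. H \<in> ?C \<Longrightarrow> K \<in> ?C \<Longrightarrow> (H, K) \<in> ?E \<longleftrightarrow> f K = Suc (f H) \<or> f H = Suc (f K)"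
      using digraph_iso_path_graph_iff by metis
    define v where "v = the_inv_into ?C f"
    have v: "bij_betw v {0..n} ?C"
      using f by (simp add: v_def bij_betw_the_inv_into)
    have fv: "f (v i) = i" "v i \<in> ?C" if "i \<le> n" for i
      using that f_the_inv_into_f_bij_betw[OF f] bij_betw_apply[OF v] by (auto simp: v_def)
    have adj: "(v i, v j) \<in> ?E \<longleftrightarrow> j = Suc i \<or> i = Suc j" if "i \<le> n" "j \<le> n" for i j
      using f_adj fv that by simp
    obtain B where "B \<in> ?C" "\<And>H. H \<in> ?C \<Longrightarrow> H \<subseteq> B"
      using greatest_if_path[OF v assms(3) adj] by blast
    then obtain g p k where "cyclic_p_group G g p k"
      using cyclic_p_group_if_greatest[OF assms(2)] by blast
    then interpret cyclic_p_group G g p k .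
    \<comment> \<open>A longer path has two vertices at distance 2, whereas this graph is complete.\<close>
    have "n = 1"
    proof (rule ccontr)
      assume "n \<noteq> 1"
      then have "v 0 \<in> ?C" "v 2 \<in> ?C" "v 0 \<noteq> v 2"
        using fv[of 0] fv[of 2] assms(3) by auto
      then have "(v 0, v 2) \<in> ?E"
        using proper_cyclic_subgroups_meet by (simp add: cyclic_intersection_graph_def)
      then show False using adj[of 0 2] \<open>n \<noteq> 1\<close> assms(3) by simp
    qed
    moreover from this have "k = 3"
      using card_proper_cyclic_subgroups bij_betw_same_card[OF f] by simp
    ultimately show "n = 1 \<and> (\<exists>p::nat. prime p \<and> G \<cong> integer_mod_group (p ^ 3))"
      using prime_p order_eq is_iso_integer_mod_group by auto
  next
    assume "n = 1 \<and> (\<exists>p::nat. prime p \<and> G \<cong> integer_mod_group (p ^ 3))"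
    then obtain p where n: "n = 1" and p: "prime p" and iso: "G \<cong> integer_mod_group (p ^ 3)" by blast
    have "cyclic_group (integer_mod_group (p ^ 3))"
      by (rule cyclic_integer_mod_group[OF one_less_power[OF prime_gt_1_nat[OF p]]]) simp
    then have "cyclic_group G"
      using isomorphic_group_cyclicity[OF iso] by (simp add: is_group)
    then obtain g where g: "g \<in> carrier G" "generate G {g} = carrier G"
      using generate_eq_range_int_pow unfolding cyclic_group by metis
    have "order G = p ^ 3"
      using iso_same_card[OF iso] prime_gt_0_nat[OF p]
      by (simp add: order_def carrier_integer_mod_group nat_power_eq)
    then interpret cyclic_p_group G g p 3
      using g p assms(2) by unfold_locales auto
    have card: "card ?C = 2"
      using card_proper_cyclic_subgroups by simp
    then have "finite ?C" by (simp add: card_ge_0_finite)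
    then obtain f where f: "bij_betw f ?C {0..1::nat}"
      using finite_same_card_bij[of ?C "{0..1::nat}"] card by auto
    have "(H, K) \<in> ?E \<longleftrightarrow> f K = Suc (f H) \<or> f H = Suc (f K)" if "H \<in> ?C" "K \<in> ?C" for H K
    proof -
      have "(H, K) \<in> ?E \<longleftrightarrow> H \<noteq> K"
        using that proper_cyclic_subgroups_meet by (auto simp: cyclic_intersection_graph_def)
      also have "\<dots> \<longleftrightarrow> f H \<noteq> f K"
        using inj_on_eq_iff[OF bij_betw_imp_inj_on[OF f]] that by simp
      also have "\<dots> \<longleftrightarrow> f K = Suc (f H) \<or> f H = Suc (f K)"
      proof -
        have "f H \<le> 1" "f K \<le> 1"
          using bij_betw_apply[OF f] that by simp_all
        then show ?thesis by linarith
      qed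
      finally show ?thesis .
    qed
    with f show "digraph_iso (with_proj (cyclic_intersection_graph G)) (with_proj (path_graph n))"
      unfolding n digraph_iso_path_graph_iff by blast
  }
qed

end
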